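(* Let $(X,d)$ be a complete metric space and let $T:X\to X$ be a continuous mapping that is an asymptotic pointwise contraction. If there exists $x_0\in X$ such that the orbit $\mathcal{O}(x_0)=\{T^n x_0 : n\in\mathbb{N}\}$ is bounded, then $T$ has a unique fixed point in $X$ and the sequence $\{T^n x_0\}$ converges to it.
   Context: $\mathbb{N}=\{0,1,2,\dots\}$. A subset $B$ of a metric space is bounded if $\operatorname{diam}(B)=\sup\{d(u,v):u,v\in B\}$ is finite. A function $\psi:[0,\infty)\to[0,\infty)$ is right upper semicontinuous if $\limsup_{t\to t_0^+}\psi(t)\le\psi(t_0)$ for every $t_0\ge 0$. It satisfies the classical Boyd--Wong condition if it is nondecreasing, right upper semicontinuous, and $\psi(t)<t$ for all $t>0$. Let $(X,d)$ be a metric space and $T:X\to X$ a mapping. Put $$M_T(x,y)=\max\{d(x,y),\,d(Tx,x),\,d(Ty,y),\,d(Ty,x),\,d(Tx,y)\}\qquad (x,y\in X).$$ $T$ is called an asymptotic pointwise contraction if there exists a sequence of functions $\varphi_n:X\times X\to[0,\infty)$, $n\in\mathbb{N}$, such that: (1) $d(T^n x,T^n y)\le\varphi_n(x,y)$ for all $x,y\in X$ and all $n\in\mathbb{N}$; (2) $\{\varphi_n\}$ converges pointwise to a function $\varphi:X\times X\to[0,\infty)$, and the convergence is uniform on $B\times B$ whenever $B\subset X$ is bounded; (3) there exists a function $\psi:[0,\infty)\to[0,\infty)$ satisfying the classical Boyd--Wong condition such that $\varphi(x,y)\le\psi(M_T(x,y))$ for all $x,y\in X$. *)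

theory Defs
  imports "HOL-Analysis.Analysis"
begin

text \<open>A function \<open>[0,\<infinity>) \<rightarrow> [0,\<infinity>)\<close> is a function on \<open>real\<close> all of whose conditions are
  restricted to the half-line; its values at negative arguments are irrelevant.\<close>

definition right_upper_semicontinuous :: "(real \<Rightarrow> real) \<Rightarrow> bool" where
  "right_upper_semicontinuous \<psi> \<longleftrightarrow>
     (\<forall>t0\<ge>0. Limsup (at_right t0) (\<lambda>t. ereal (\<psi> t)) \<le> ereal (\<psi> t0))"

definition boyd_wong :: "(real \<Rightarrow> real) \<Rightarrow> bool" where
  "boyd_wong \<psi> \<longleftrightarrow>
     (\<forall>t\<ge>0. \<psi> t \<ge> 0) \<and>
     mono_on {0..} \<psi> \<and>
     right_upper_semicontinuous \<psi> \<and>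
     (\<forall>t>0. \<psi> t < t)"

definition M_max :: "('a::metric_space \<Rightarrow> 'a) \<Rightarrow> 'a \<Rightarrow> 'a \<Rightarrow> real" where
  "M_max T x y =
     Max {dist x y, dist (T x) x, dist (T y) y, dist (T y) x, dist (T x) y}"

definition asymptotic_pointwise_contraction :: "('a::metric_space \<Rightarrow> 'a) \<Rightarrow> bool" where
  "asymptotic_pointwise_contraction T \<longleftrightarrow>
     (\<exists>(\<phi>n :: nat \<Rightarrow> 'a \<times> 'a \<Rightarrow> real) (\<phi> :: 'a \<times> 'a \<Rightarrow> real).
        (\<forall>n p. \<phi>n n p \<ge> 0) \<and>
        (\<forall>p. \<phi> p \<ge> 0) \<and>
        (\<forall>n x y. dist ((T ^^ n) x) ((T ^^ n) y) \<le> \<phi>n n (x, y)) \<and>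
        (\<forall>p. (\<lambda>n. \<phi>n n p) \<longlonglongrightarrow> \<phi> p) \<and>
        (\<forall>B. bounded B \<longrightarrow> uniform_limit (B \<times> B) \<phi>n \<phi> sequentially) \<and>
        (\<exists>\<psi>. boyd_wong \<psi> \<and> (\<forall>x y. \<phi> (x, y) \<le> \<psi> (M_max T x y))))"

end

theory Submission
  imports Defs
begin

text \<open>The diameters of the tails of a bounded orbit decrease to some \<open>r \<ge> 0\<close>. On the tail from
  \<open>k\<close> on, \<open>M_max T\<close> is at most the diameter \<open>a k\<close> of that tail, so uniform convergence on the orbit
  yields \<open>r \<le> \<psi> (a k)\<close>. Monotonicity then gives \<open>r \<le> \<psi> t\<close> for all \<open>t > r\<close>, whence \<open>r \<le> \<psi> r\<close> by right
  upper semicontinuity and so \<open>r = 0\<close>: the orbit is Cauchy.\<close>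

lemma boyd_wong_eq_0:
  assumes "boyd_wong \<psi>" "r \<ge> 0" and le: "\<And>t. t > r \<Longrightarrow> r \<le> \<psi> t"
  shows "r = 0"
proof -
  \<comment> \<open>The filter \<open>at_right r\<close> is nontrivial, so a constant is its own
    upper limit there.\<close>
  have "ereal r = Limsup (at_right r) (\<lambda>t. ereal r)"
    by (simp add: Limsup_const)
  also have "\<dots> \<le> Limsup (at_right r) (\<lambda>t. ereal (\<psi> t))"
    by (intro Limsup_mono) (auto simp: eventually_at_filter le)
  also have "\<dots> \<le> ereal (\<psi> r)"
    using assms(1,2) by (simp add: boyd_wong_def right_upper_semicontinuous_def)
  finally have "r \<le> \<psi> r" by simp
  then show ?thesis
    using assms(1,2) unfolding boyd_wong_def by (metis not_le order_le_less)
qed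

text \<open>Meant for tails of the orbit: these are closed under \<open>T\<close>, so all five
  distances are between points of \<open>S\<close>.\<close>

lemma M_max_le_diameter:
  assumes "bounded S" "x \<in> S" "y \<in> S" "T x \<in> S" "T y \<in> S"
  shows "M_max T x y \<le> diameter S"
  unfolding M_max_def using assms by (auto intro: diameter_bounded_bound)

lemma M_max_nonneg: "0 \<le> M_max T x y"
  unfolding M_max_def by (simp add: le_max_iff_disj)

text \<open>Serves uniqueness: on two fixed points the bound by \<open>\<psi>\<close> becomes one in
  terms of their distance alone.\<close>

lemma M_max_fixed_points:
  assumes "T x = x" "T y = y"
  shows "M_max T x y = dist x y"
proof -
  have "{dist x y, dist (T x) x, dist (T y) y, dist (T y) x, dist (T x) y} = {0, dist x y}"
    using assms by (auto simp: dist_commute)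
  then show ?thesis unfolding M_max_def by simp
qed

lemma funpow_fixed_point: "T x = x \<Longrightarrow> (T ^^ n) x = x"
  by (induction n) auto

text \<open>The shifted sequence keeps the limit \<open>z\<close>, while continuity sends it to
  \<open>T z\<close>.\<close>

lemma LIMSEQ_funpow_fixed_point:
  fixes T :: "'a::t2_space \<Rightarrow> 'a"
  assumes "continuous_on UNIV T" and lim: "(\<lambda>n. (T ^^ n) x) \<longlonglongrightarrow> z"
  shows "T z = z"
proof -
  have "(\<lambda>n. T ((T ^^ n) x)) \<longlonglongrightarrow> T z"
    using continuous_on_tendsto_compose[OF assms] by simp
  moreover have "(\<lambda>n. T ((T ^^ n) x)) \<longlonglongrightarrow> z"
    using LIMSEQ_Suc[OF lim] by simp
  ultimately show ?thesis by (rule LIMSEQ_unique)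
qed

text \<open>Some tail has diameter below \<open>e\<close>. Boundedness makes \<open>diameter\<close>
  a genuine supremum, hence a bound for the distances in that tail.\<close>

lemma Cauchy_if_diameter_tails:
  fixes u :: "nat \<Rightarrow> 'a::metric_space"
  assumes "bounded (range u)" and "(INF k. diameter (u ` {k..})) = 0"
  shows "Cauchy u"
proof (rule metric_CauchyI)
  fix e :: real assume "e > 0"
  moreover have "bdd_below (range (\<lambda>k. diameter (u ` {k..})))"
    by (rule bdd_belowI[of _ 0])
       (auto intro!: diameter_ge_0 bounded_subset[OF assms(1)])
  ultimately obtain k where "diameter (u ` {k..}) < e"
    using assms(2) cINF_less_iff[OF UNIV_not_empty, of "\<lambda>k. diameter (u ` {k..})" e] by auto
  moreover have "bounded (u ` {k..})"
    by (rule bounded_subset[OF assms(1)]) auto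
  ultimately show "\<exists>M. \<forall>m\<ge>M. \<forall>n\<ge>M. dist (u m) (u n) < e"
    by (meson atLeast_iff diameter_bounded_bound imageI le_less_trans)
qed

theorem theorem3p1:
  fixes T :: "'a::complete_space \<Rightarrow> 'a" and x0 :: 'a
  assumes "continuous_on UNIV T"
    and "asymptotic_pointwise_contraction T"
    and "bounded (range (\<lambda>n. (T ^^ n) x0))"
  shows "\<exists>z. T z = z \<and> (\<forall>w. T w = w \<longrightarrow> w = z) \<and> (\<lambda>n. (T ^^ n) x0) \<longlonglongrightarrow> z"
proof -
  obtain \<phi>n \<phi> \<psi> where
    "\<forall>p. (\<lambda>n. \<phi>n n p) \<longlonglongrightarrow> \<phi> p"
    "\<forall>n x y. dist ((T ^^ n) x) ((T ^^ n) y) \<le> \<phi>n n (x, y)"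
    "\<forall>B. bounded B \<longrightarrow> uniform_limit (B \<times> B) \<phi>n \<phi> sequentially"
    "\<forall>x y. \<phi> (x, y) \<le> \<psi> (M_max T x y)"
    and bw: "boyd_wong \<psi>"
    using assms(2) unfolding asymptotic_pointwise_contraction_def
    by (elim exE conjE) (rule that)
  note lim = this(1)[rule_format] and dist_le = this(2)[rule_format]
    and unif = this(3)[rule_format] and \<phi>_le = this(4)[rule_format]
  have mono: "\<psi> s \<le> \<psi> t" if "0 \<le> s" "s \<le> t" for s t
    using bw that unfolding boyd_wong_def by (auto elim!: mono_onD)
  \<comment> \<open>Iterates leave both points in place, so their distance is below every
    \<open>\<phi>n n (w, z)\<close> and thus below the limit; a positive distance would contradict
    \<open>\<psi> t < t\<close>.\<close>
  have unique: "w = z" if "T w = w" "T z = z" for w z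
  proof -
    have "dist w z \<le> \<phi> (w, z)"
      using dist_le[of _ w z] that
      by (intro LIMSEQ_le_const[OF lim]) (auto simp: funpow_fixed_point)
    also have "\<dots> \<le> \<psi> (dist w z)"
      using \<phi>_le[of w z] that by (simp add: M_max_fixed_points)
    finally show ?thesis
      using bw unfolding boyd_wong_def by (metis not_le zero_less_dist_iff)
  qed
  define u where "u n = (T ^^ n) x0" for n
  define a where "a k = diameter (u ` {k..})" for k
  define r where "r = (INF k. a k)"
  have bdd: "bounded (range u)"
    using assms(3) by (simp add: u_def)
  have bdd_tail: "bounded (u ` {k..})" for k
    by (rule bounded_subset[OF bdd]) auto
  have a_nonneg: "0 \<le> a k" for k
    unfolding a_def by (rule diameter_ge_0[OF bdd_tail])
  have bdd_a: "bdd_below (range a)"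
    by (rule bdd_belowI[of _ 0]) (auto simp: a_nonneg)
  have r_le: "r \<le> \<psi> (a k)" for k
  proof (rule field_le_epsilon)
    fix e :: real assume "e > 0"
    \<comment> \<open>Uniformity provides one \<open>N\<close> for all pairs of orbit points at
      once.\<close>
    then obtain N where N: "\<And>p. p \<in> range u \<times> range u \<Longrightarrow> dist (\<phi>n N p) (\<phi> p) < e"
      using uniform_limitD[OF unif[OF bdd]] unfolding eventually_sequentially by blast
    have "dist (u i) (u j) \<le> \<psi> (a k) + e" if ij: "i \<ge> k + N" "j \<ge> k + N" for i j
    proof -
      \<comment> \<open>Going back \<open>N\<close> steps stays in the tail from \<open>k\<close>
        on, and \<open>T ^^ N\<close> maps the earlier pair to \<open>(u i, u j)\<close>.\<close>
      define p q where "p = i - N" and "q = j - N"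
      have pq: "p \<ge> k" "q \<ge> k" "i = N + p" "j = N + q"
        using ij by (auto simp: p_def q_def)
      have T_u: "T (u n) = u (Suc n)" for n
        by (simp add: u_def)
      have "dist (u i) (u j) \<le> \<phi>n N (u p, u q)"
        using dist_le[of N "u p" "u q"] by (simp add: pq u_def funpow_add)
      also have "\<dots> \<le> \<phi> (u p, u q) + e"
        using N[of "(u p, u q)"] by (auto simp: dist_real_def)
      also have "\<phi> (u p, u q) \<le> \<psi> (M_max T (u p) (u q))"
        by (rule \<phi>_le)
      also have "\<dots> \<le> \<psi> (a k)"
        unfolding a_def using pq
        \<comment> \<open>Nonnegativity of \<open>M_max\<close> is required because
          \<open>\<psi>\<close> is monotone only on the half-line.\<close>
        by (intro mono M_max_nonneg M_max_le_diameter bdd_tail) (auto simp: T_u)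
      finally show ?thesis by simp
    qed
    then have "a (k + N) \<le> \<psi> (a k) + e"
      unfolding a_def[of "k + N"] diameter_def by (auto intro!: cSUP_least)
    moreover have "r \<le> a (k + N)"
      unfolding r_def by (rule cINF_lower[OF bdd_a]) simp
    ultimately show "r \<le> \<psi> (a k) + e" by linarith
  qed
  have "r = 0"
  proof (rule boyd_wong_eq_0[OF bw])
    show "0 \<le> r"
      unfolding r_def by (rule cINF_greatest) (auto simp: a_nonneg)
    fix t assume "t > r"
    \<comment> \<open>As \<open>r\<close> is the infimum of the diameters, some \<open>a k\<close>
      lies below \<open>t\<close>, and monotonicity lifts the bound from \<open>a k\<close> to
      \<open>t\<close>.\<close>
    then obtain k where "a k < t"
      using cINF_less_iff[OF UNIV_not_empty bdd_a] by (auto simp: r_def)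
    then show "r \<le> \<psi> t"
      using r_le[of k] mono[OF a_nonneg[of k], of t] by linarith
  qed
  then have "Cauchy u"
    using Cauchy_if_diameter_tails[OF bdd] by (simp add: r_def a_def)
  then obtain z where z: "u \<longlonglongrightarrow> z"
    using Cauchy_convergent convergent_def by blast
  then have "T z = z"
    using LIMSEQ_funpow_fixed_point[OF assms(1)] by (simp add: u_def[abs_def])
  then show ?thesis
    using unique z by (auto simp: u_def[abs_def])
qed

end
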